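(* Let $\alpha_0=-\log(\sqrt{2}-1)$ (so $\alpha_0\approx 0.8814$). For all $x\in[0,1]$, $$\exp(-x)\leq \sqrt{1+x^2}-x\leq \exp(-\alpha_0 x).$$ Moreover, these are the best possible rates in the exponentials with multiplicative constant $1$: if $\alpha>0$ satisfies $\exp(-\alpha x)\leq\sqrt{1+x^2}-x$ for all $x\in[0,1]$, then $\alpha\geq 1$; and if $\alpha>0$ satisfies $\sqrt{1+x^2}-x\leq\exp(-\alpha x)$ for all $x\in[0,1]$, then $\alpha\leq\alpha_0$.
   Context: $\log$ denotes the natural logarithm. *)

theory Defs
  imports Complex_Main
begin

definition alpha0 :: real where
  "alpha0 = - ln (sqrt 2 - 1)"

end

theory Submission
  imports Defs "HOL-Analysis.Convex"
begin

text \<open>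
  Since \<open>sqrt (1 + x\<^sup>2) - x = exp (- arsinh x)\<close> and \<open>alpha0 = arsinh 1\<close>, everything reduces to
  linear bounds on \<open>arsinh\<close>. The convexity of \<open>sinh\<close> on the nonnegative reals puts the graph of
  \<open>arsinh\<close> over the unit interval between its tangent at 0, of slope 1, and its chord, of slope
  \<open>alpha0\<close>. The tangent slope is recovered as the limit of \<open>arsinh x / x\<close> at 0, the chord slope
  at \<open>x = 1\<close>.
\<close>

text \<open>Take \<open>y = arsinh x\<close> in \<open>exp (- y) = cosh y - sinh y\<close>, where
  \<open>cosh y = sqrt (1 + x\<^sup>2)\<close>.\<close>

lemma exp_minus_arsinh_real: "exp (- arsinh x) = sqrt (1 + x\<^sup>2) - x" for x :: real
  by (simp add: cosh_minus_sinh[symmetric] cosh_arsinh_real add.commute)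

lemma alpha0_eq_arsinh: "alpha0 = arsinh 1"
proof -
  have "sqrt 2 - 1 = exp (- arsinh (1::real))"
    by (simp add: exp_minus_arsinh_real)
  then show ?thesis
    by (simp add: alpha0_def)
qed

lemma arsinh_real_le: "arsinh x \<le> x" if "x \<ge> 0" for x :: real
proof -
  have "x \<le> sinh x"
    using real_le_x_sinh[OF that] by (simp add: sinh_field_def exp_minus)
  then have "sinh (arsinh x) \<le> sinh x"
    by simp
  then show ?thesis
    by (simp only: sinh_real_le_iff)
qed

lemma convex_on_sinh: "convex_on {0..} (sinh :: real \<Rightarrow> real)"
  by (rule f''_ge0_imp_convex[where f' = cosh and f'' = sinh]) (auto intro!: derivative_eq_intros)

lemma arsinh_real_ge_chord: "arsinh 1 * x \<le> arsinh x" if "0 \<le> x" "x \<le> 1" for x :: real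
proof -
  have "0 \<le> arsinh (1::real)"
    using arsinh_real_pos_iff[of 1] by linarith
  \<comment> \<open>Convexity between 0 and \<open>arsinh 1\<close> with weight \<open>x\<close>
    bounds the left side by \<open>x * sinh (arsinh 1) = x\<close>.\<close>
  then have "sinh (arsinh 1 * x) \<le> sinh (arsinh x)"
    using convex_onD[OF convex_on_sinh, of x 0 "arsinh 1"] that by (simp add: mult.commute)
  then show ?thesis
    by (simp only: sinh_real_le_iff)
qed

lemma arsinh_real_slope_ge_1:
  fixes a :: real
  assumes "\<And>x. 0 < x \<Longrightarrow> x \<le> 1 \<Longrightarrow> arsinh x \<le> a * x"
  shows "1 \<le> a"
proof -
  have "(arsinh has_field_derivative 1) (at (0::real))"
    using arsinh_real_has_field_derivative[of 0 UNIV] by simp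
  \<comment> \<open>As \<open>arsinh 0 = 0\<close>, the difference quotient at 0 is
    \<open>arsinh x / x\<close>; its two-sided limit is restricted to the right, where the
    assumption bounds it by \<open>a\<close>.\<close>
  then have "((\<lambda>x::real. arsinh x / x) \<longlongrightarrow> 1) (at_right 0)"
    by (auto simp: DERIV_def intro: filterlim_mono at_le)
  moreover have "\<forall>\<^sub>F x in at_right 0. arsinh x / x \<le> a"
    unfolding eventually_at_right_field
    using assms by (intro exI[of _ 1]) (auto simp: field_simps)
  ultimately show ?thesis
    by (rule tendsto_upperbound) simp
qed

theorem proposition1:
  shows "(\<forall>x::real. x \<in> {0..1} \<longrightarrow>
            exp (- x) \<le> sqrt (1 + x\<^sup>2) - x \<and>
            sqrt (1 + x\<^sup>2) - x \<le> exp (- alpha0 * x)) \<and>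
         (\<forall>\<alpha>::real. \<alpha> > 0 \<longrightarrow>
            (\<forall>x::real. x \<in> {0..1} \<longrightarrow> exp (- \<alpha> * x) \<le> sqrt (1 + x\<^sup>2) - x) \<longrightarrow>
            \<alpha> \<ge> 1) \<and>
         (\<forall>\<alpha>::real. \<alpha> > 0 \<longrightarrow>
            (\<forall>x::real. x \<in> {0..1} \<longrightarrow> sqrt (1 + x\<^sup>2) - x \<le> exp (- \<alpha> * x)) \<longrightarrow>
            \<alpha> \<le> alpha0)"
proof (intro conjI allI impI)
  fix x :: real
  assume x: "x \<in> {0..1}"
  show "exp (- x) \<le> sqrt (1 + x\<^sup>2) - x"
    using arsinh_real_le x by (simp flip: exp_minus_arsinh_real)
  show "sqrt (1 + x\<^sup>2) - x \<le> exp (- alpha0 * x)"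
    using arsinh_real_ge_chord x by (simp add: alpha0_eq_arsinh flip: exp_minus_arsinh_real)
next
  fix \<alpha> :: real
  assume lower: "\<forall>x::real. x \<in> {0..1} \<longrightarrow> exp (- \<alpha> * x) \<le> sqrt (1 + x\<^sup>2) - x"
  then show "\<alpha> \<ge> 1"
    by (intro arsinh_real_slope_ge_1) (simp flip: exp_minus_arsinh_real)
next
  fix \<alpha> :: real
  assume upper: "\<forall>x::real. x \<in> {0..1} \<longrightarrow> sqrt (1 + x\<^sup>2) - x \<le> exp (- \<alpha> * x)"
  show "\<alpha> \<le> alpha0"
    \<comment> \<open>At \<open>x = 1\<close> the assumption reads
      \<open>exp (- alpha0) \<le> exp (- \<alpha>)\<close>.\<close>
    using upper[rule_format, of 1] unfolding exp_minus_arsinh_real[symmetric] alpha0_eq_arsinh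
    by simp
qed

end
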